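(* Let $R$ and $C$ be disjoint finite or countable sets, let $I\subseteq R\times C$, and let $G$ be the bipartite graph with vertex classes $C$ and $R$ whose edges are the pairs $\{r,c\}$ with $(r,c)\in I$. Let $p\in\{2,4,6,\dots\}$. The sequence $(\mathrm e_{rc})_{(r,c)\in I}$ is a complex $1$-unconditional basic sequence in $S^p$ if and only if $G$ contains no cycle of length $4,6,\dots,p$. Likewise, it is a real $1$-unconditional basic sequence in $S^p$ if and only if $G$ contains no cycle of length $4,6,\dots,p$.
   Context: $\mathrm e_{rc}$ is the elementary matrix, i.e. the operator from $\ell^2_C$ to $\ell^2_R$ mapping the basis vector $\mathrm e_c$ to $\mathrm e_r$ and all other basis vectors to $0$. $S^p$ is the Schatten-von-Neumann class of compact operators $x\colon\ell^2_C\to\ell^2_R$ with $\|x\|_p^p=\operatorname{tr}(x^*x)^{p/2}<\infty$. The sequence $(\mathrm e_{q})_{q\in I}$ is a complex (resp. real) $1$-unconditional basic sequence in $S^p$ if $\|\sum_{q\in I}\epsilon_qa_q\mathrm e_q\|_p=\|\sum_{q\in I}a_q\mathrm e_q\|_p$ for every choice of $\epsilon_q\in\mathbb T=\{z\in\mathbb C:|z|=1\}$ (resp. $\epsilon_q\in\{-1,1\}$) and every finitely supported family of complex coefficients $(a_q)_{q\in I}$. A cycle of length $l\ge 4$ is a closed walk $(v_1,\dots,v_l)$ in the graph with pairwise distinct vertices. *)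

theory Defs
  imports "HOL-Analysis.Analysis"
begin

text \<open>The Hilbert space of square-summable families indexed by a set; its elements are
  functions on the whole type that vanish off the index set. The inner product is linear in
  the first argument.\<close>

definition ell2 :: "'a set \<Rightarrow> ('a \<Rightarrow> complex) set" where
  "ell2 A = {f. (\<forall>i. i \<notin> A \<longrightarrow> f i = 0) \<and> (\<lambda>i. (cmod (f i))\<^sup>2) summable_on A}"

definition ell2_inner :: "'a set \<Rightarrow> ('a \<Rightarrow> complex) \<Rightarrow> ('a \<Rightarrow> complex) \<Rightarrow> complex" where
  "ell2_inner A f g = (\<Sum>\<^sub>\<infinity>i\<in>A. f i * cnj (g i))"

definition ell2_norm :: "'a set \<Rightarrow> ('a \<Rightarrow> complex) \<Rightarrow> real" where
  "ell2_norm A f = sqrt (\<Sum>\<^sub>\<infinity>i\<in>A. (cmod (f i))\<^sup>2)"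

definition basis_vec :: "'a \<Rightarrow> 'a \<Rightarrow> complex" where
  "basis_vec i = (\<lambda>j. if j = i then 1 else 0)"

text \<open>An operator from \<open>ell2 A\<close> to \<open>ell2 B\<close> is a map on functions of which only the values on
  \<open>ell2 A\<close> matter.\<close>

type_synonym ('a, 'b) operator = "('a \<Rightarrow> complex) \<Rightarrow> ('b \<Rightarrow> complex)"

definition linear_operator :: "'a set \<Rightarrow> 'b set \<Rightarrow> ('a, 'b) operator \<Rightarrow> bool" where
  "linear_operator A B x \<longleftrightarrow>
     (\<forall>f\<in>ell2 A. x f \<in> ell2 B) \<and>
     (\<forall>f\<in>ell2 A. \<forall>g\<in>ell2 A. x (\<lambda>i. f i + g i) = (\<lambda>j. x f j + x g j)) \<and>
     (\<forall>z. \<forall>f\<in>ell2 A. x (\<lambda>i. z * f i) = (\<lambda>j. z * x f j))"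

text \<open>Compactness in its sequential form: the image of every sequence in the unit ball has a
  norm-convergent subsequence. Boundedness is a consequence.\<close>

definition compact_operator :: "'a set \<Rightarrow> 'b set \<Rightarrow> ('a, 'b) operator \<Rightarrow> bool" where
  "compact_operator A B x \<longleftrightarrow>
     linear_operator A B x \<and>
     (\<forall>F :: nat \<Rightarrow> 'a \<Rightarrow> complex. (\<forall>n. F n \<in> ell2 A \<and> ell2_norm A (F n) \<le> 1) \<longrightarrow>
        (\<exists>g\<in>ell2 B. \<exists>s :: nat \<Rightarrow> nat. strict_mono s \<and>
           (\<lambda>n. ell2_norm B (\<lambda>j. x (F (s n)) j - g j)) \<longlonglongrightarrow> 0))"

definition adjoint_op :: "'a set \<Rightarrow> 'b set \<Rightarrow> ('a, 'b) operator \<Rightarrow> ('b, 'a) operator" where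
  "adjoint_op A B x g =
     (THE h. h \<in> ell2 A \<and> (\<forall>f\<in>ell2 A. ell2_inner B (x f) g = ell2_inner A f h))"

text \<open>The power \<open>(x\<^sup>* x)\<^bsup>p/2\<^esup>\<close>. The exponent \<open>p\<close> is always an even natural number
  here, so this is an ordinary iterate and no functional calculus is involved.\<close>

definition gram_power :: "'a set \<Rightarrow> 'b set \<Rightarrow> nat \<Rightarrow> ('a, 'b) operator \<Rightarrow> ('a, 'a) operator" where
  "gram_power A B p x = (\<lambda>f. adjoint_op A B x (x f)) ^^ (p div 2)"

definition op_trace :: "'a set \<Rightarrow> ('a, 'a) operator \<Rightarrow> complex" where
  "op_trace A T = (\<Sum>\<^sub>\<infinity>i\<in>A. ell2_inner A (T (basis_vec i)) (basis_vec i))"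

text \<open>As \<open>(x\<^sup>* x)\<^bsup>p/2\<^esup>\<close> is positive, its trace is finite if and only if the diagonal is
  summable. The summability has to be stated separately because a divergent \<open>infsum\<close> is 0.\<close>

definition schatten_class :: "'a set \<Rightarrow> 'b set \<Rightarrow> nat \<Rightarrow> ('a, 'b) operator set" where
  "schatten_class A B p =
     {x. compact_operator A B x \<and>
         (\<lambda>i. ell2_inner A (gram_power A B p x (basis_vec i)) (basis_vec i)) summable_on A}"

definition schatten_norm :: "'a set \<Rightarrow> 'b set \<Rightarrow> nat \<Rightarrow> ('a, 'b) operator \<Rightarrow> real" where
  "schatten_norm A B p x = root p (Re (op_trace A (gram_power A B p x)))"

definition elem_op :: "'b \<Rightarrow> 'a \<Rightarrow> ('a, 'b) operator" where
  "elem_op r c f = (\<lambda>j. f c * basis_vec r j)"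

text \<open>The sum of \<open>a q\<close> times \<open>e q\<close> over \<open>q \<in> I\<close>, for a family \<open>a\<close> of finite support in \<open>I\<close>.\<close>

definition lin_comb :: "'q set \<Rightarrow> ('q \<Rightarrow> complex) \<Rightarrow> ('q \<Rightarrow> ('a, 'b) operator) \<Rightarrow> ('a, 'b) operator"
  where "lin_comb I a e f = (\<lambda>j. \<Sum>q\<in>{q\<in>I. a q \<noteq> 0}. a q * e q f j)"

definition one_unconditional_wrt ::
  "complex set \<Rightarrow> 'a set \<Rightarrow> 'b set \<Rightarrow> nat \<Rightarrow> 'q set \<Rightarrow> ('q \<Rightarrow> ('a, 'b) operator) \<Rightarrow> bool" where
  "one_unconditional_wrt S A B p I e \<longleftrightarrow>
     (\<forall>q\<in>I. e q \<in> schatten_class A B p) \<and>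
     (\<forall>\<epsilon> a. (\<forall>q\<in>I. \<epsilon> q \<in> S) \<longrightarrow> finite {q\<in>I. a q \<noteq> 0} \<longrightarrow>
        schatten_norm A B p (lin_comb I (\<lambda>q. \<epsilon> q * a q) e) =
        schatten_norm A B p (lin_comb I a e))"

definition complex_one_unconditional ::
  "'a set \<Rightarrow> 'b set \<Rightarrow> nat \<Rightarrow> 'q set \<Rightarrow> ('q \<Rightarrow> ('a, 'b) operator) \<Rightarrow> bool" where
  "complex_one_unconditional = one_unconditional_wrt {z. cmod z = 1}"

text \<open>Real unconditionality restricts the signs only; the coefficients remain complex.\<close>

definition real_one_unconditional ::
  "'a set \<Rightarrow> 'b set \<Rightarrow> nat \<Rightarrow> 'q set \<Rightarrow> ('q \<Rightarrow> ('a, 'b) operator) \<Rightarrow> bool" where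
  "real_one_unconditional = one_unconditional_wrt {-1, 1}"

text \<open>The graph on the vertex set \<open>C \<union> R\<close> is given by its set of edges, which are
  two-element sets when \<open>R\<close> and \<open>C\<close> are disjoint.\<close>

definition bip_edges :: "('v \<times> 'v) set \<Rightarrow> 'v set set" where
  "bip_edges I = {{r, c} | r c. (r, c) \<in> I}"

definition closed_walk :: "'v set \<Rightarrow> 'v set set \<Rightarrow> 'v list \<Rightarrow> bool" where
  "closed_walk V E vs \<longleftrightarrow> vs \<noteq> [] \<and> set vs \<subseteq> V \<and>
     (\<forall>i. Suc i < length vs \<longrightarrow> {vs ! i, vs ! Suc i} \<in> E) \<and> {last vs, hd vs} \<in> E"

definition is_cycle :: "'v set \<Rightarrow> 'v set set \<Rightarrow> 'v list \<Rightarrow> bool" where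
  "is_cycle V E vs \<longleftrightarrow> closed_walk V E vs \<and> distinct vs \<and> 4 \<le> length vs"

end

theory Submission
  imports Defs
begin

text \<open>For \<open>x = \<Sum> a\<^sub>q e\<^sub>q\<close> the number \<open>\<parallel>x\<parallel>\<^sub>p\<^sup>p\<close> is the sum, over all closed walks of length \<open>p\<close> starting in
  \<open>C\<close>, of the product of the weights \<open>a\<^sub>r\<^sub>c\<close> (step from \<open>r\<close> to \<open>c\<close>) and their conjugates (step from
  \<open>c\<close> to \<open>r\<close>). If there is no cycle of length at most \<open>p\<close>, such a walk runs through each edge
  equally often in both directions, so unimodular factors cancel. A cycle of length at most \<open>p\<close>
  yields a walk that uses one of its edges an odd number of times, and changing the sign of that
  edge makes the sum strictly smaller.\<close>

subsection \<open>Weights of closed walks\<close>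

text \<open>A list of n + 1 vertices is a walk of n steps, and the weights sit on the steps. Values
  in any commutative monoid let one product serve complex entries and their absolute values.\<close>

fun walk_weight :: "('v \<Rightarrow> 'v \<Rightarrow> 'k::comm_monoid_mult) \<Rightarrow> 'v list \<Rightarrow> 'k" where
  "walk_weight w (u # v # vs) = w u v * walk_weight w (v # vs)"
| "walk_weight w _ = 1"

lemma walk_weight_append:
  "walk_weight w (us @ v # vs) = walk_weight w (us @ [v]) * walk_weight w (v # vs)"
  by (induction w us rule: walk_weight.induct) (auto simp: mult_ac)

lemma walk_weight_mult:
  "walk_weight (\<lambda>u v. s u v * w u v) vs = walk_weight s vs * walk_weight w vs"
  by (induction w vs rule: walk_weight.induct) (auto simp: mult_ac)

lemma walk_weight_cong:
  "successively (\<lambda>u v. w u v = w' u v) vs \<Longrightarrow> walk_weight w vs = walk_weight w' vs"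
  by (induction w vs rule: walk_weight.induct) auto

lemma walk_weight_1: "walk_weight (\<lambda>u v. 1) vs = 1"
  by (induction vs rule: induct_list012) auto

lemma walk_weight_norm:
  fixes w :: "'v \<Rightarrow> 'v \<Rightarrow> 'k::real_normed_field"
  shows "norm (walk_weight w vs) = walk_weight (\<lambda>u v. norm (w u v)) vs"
  by (induction w vs rule: walk_weight.induct) (auto simp: norm_mult)

lemma walk_weight_of_real:
  "walk_weight (\<lambda>u v. of_real (w u v) :: complex) vs = of_real (walk_weight w vs)"
  by (induction w vs rule: walk_weight.induct) auto

lemma walk_weight_nonzero:
  fixes w :: "'v \<Rightarrow> 'v \<Rightarrow> 'k::idom"
  shows "walk_weight w vs \<noteq> 0 \<longleftrightarrow> successively (\<lambda>u v. w u v \<noteq> 0) vs"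
  by (induction w vs rule: walk_weight.induct) auto

text \<open>Every step switches between \<open>C\<close> and its complement, and there is one step
  fewer than there are vertices.\<close>

lemma successively_bipartite_parity:
  assumes "successively (\<lambda>u v. u \<in> C \<longleftrightarrow> v \<notin> C) vs" "vs \<noteq> []"
  shows "(last vs \<in> C \<longleftrightarrow> hd vs \<in> C) \<longleftrightarrow> odd (length vs)"
  using assms
  by (induction "\<lambda>u v. u \<in> C \<longleftrightarrow> v \<notin> C" vs rule: successively.induct) auto

lemma closed_walk_iff_successively:
  "closed_walk V E vs \<longleftrightarrow>
     vs \<noteq> [] \<and> set vs \<subseteq> V \<and> successively (\<lambda>u v. {u, v} \<in> E) vs \<and> {last vs, hd vs} \<in> E"
  by (simp add: closed_walk_def successively_conv_nth)

text \<open>A repeated vertex splits a closed walk into two shorter ones, so only cycles and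
  single edges run forth and back remain.\<close>

lemma walk_weight_closed_eq_1:
  fixes s :: "'v \<Rightarrow> 'v \<Rightarrow> 'k::comm_monoid_mult"
  assumes no_cycle: "\<And>vs. is_cycle V E vs \<Longrightarrow> even (length vs) \<Longrightarrow> length vs \<le> n \<Longrightarrow> False"
    and inv: "\<And>u v. {u, v} \<in> E \<Longrightarrow> s u v * s v u = 1"
    and bip: "\<And>u v. {u, v} \<in> E \<Longrightarrow> u \<in> C \<longleftrightarrow> v \<notin> C"
    and sub: "\<And>u v. {u, v} \<in> E \<Longrightarrow> u \<in> V"
    and walk: "successively (\<lambda>u v. {u, v} \<in> E) (v # vs)"
    and closed: "last (v # vs) = v" and len: "length vs \<le> n"
  shows "walk_weight s (v # vs) = 1"
  using walk closed len
proof (induction "length vs" arbitrary: v vs rule: less_induct)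
  case less
  show ?case
  \<comment> \<open>For nonempty \<open>vs\<close> the start \<open>v\<close> recurs as its last
    entry, so distinctness of \<open>vs\<close>, not of \<open>v # vs\<close>, singles out the walks
    without further repetition.\<close>
  proof (cases "distinct vs")
    case False
    then obtain as x bs cs where vs: "vs = as @ [x] @ bs @ [x] @ cs"
      using not_distinct_decomp by metis
    \<comment> \<open>The loop from \<open>x\<close> back to \<open>x\<close> and the walk left
      after cutting it out are both closed and shorter.\<close>
    have 1: "walk_weight s (x # bs @ [x]) = 1"
      using less.prems by (intro less.hyps) (auto simp: vs successively_append_iff successively_Cons hd_append)
    have 2: "walk_weight s (v # as @ x # cs) = 1"
      using less.prems
      by (intro less.hyps) (auto simp: vs successively_append_iff successively_Cons hd_append split: if_splits)
    have "walk_weight s (v # vs) = walk_weight s ((v # as) @ x # bs @ x # cs)"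
      by (simp add: vs)
    also have "\<dots> = walk_weight s (v # as @ [x]) * (walk_weight s (x # bs @ [x]) * walk_weight s (x # cs))"
      using walk_weight_append[of s "v # as" x "bs @ x # cs"] walk_weight_append[of s "x # bs" x cs]
      by simp
    also have "\<dots> = walk_weight s (v # as @ x # cs)"
      using walk_weight_append[of s "v # as" x cs] by (simp add: 1)
    finally show ?thesis using 2 by simp
  next
    case True
    have "successively (\<lambda>u v. u \<in> C \<longleftrightarrow> v \<notin> C) (v # vs)"
      by (rule successively_mono[OF less.prems(1)]) (rule bip)
    from successively_bipartite_parity[OF this] have ev: "even (length vs)"
      using less.prems(2) by simp
    show ?thesis
    proof (cases "length vs < 4")
      case True
      with ev have "length vs = 0 \<or> length vs = 2" by presburger
      then show ?thesis
      proof
        assume "length vs = 2"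
        \<comment> \<open>Here \<open>y\<close> is \<open>v\<close>: the walk goes over one edge and
          back, and \<open>inv\<close> applies.\<close>
        then obtain x y where "vs = [x, y]"
          by (auto simp: length_Suc_conv numeral_2_eq_2)
        with less.prems show ?thesis by (auto simp: inv)
      qed simp
    next
      case False
      then have ne: "vs \<noteq> []" by auto
      have succ: "successively (\<lambda>u v. {u, v} \<in> E) vs" and e: "{v, hd vs} \<in> E"
        using less.prems(1) ne by (auto simp: successively_Cons)
      have "w \<in> V" if "w \<in> set vs" for w
      proof -
        from that obtain i where i: "i < length vs" "w = vs ! i" by (auto simp: in_set_conv_nth)
        show ?thesis
        \<comment> \<open>\<open>sub\<close> concerns the first vertex of an edge. The last entry of
          \<open>vs\<close> has no successor, but it is \<open>v\<close>, which starts the edge to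
          \<open>hd vs\<close>.\<close>
        proof (cases "Suc i < length vs")
          case True
          with succ i show ?thesis by (auto simp: successively_conv_nth intro: sub)
        next
          case False
          with i have "i = length vs - 1" by simp
          with i ne have "w = last vs" by (simp add: last_conv_nth)
          with less.prems(2) ne e show ?thesis by (auto intro: sub)
        qed
      qed
      then have "is_cycle V E vs"
        using succ e ne less.prems(2) False \<open>distinct vs\<close>
        by (auto simp: is_cycle_def closed_walk_iff_successively)
      with ev less.prems(3) no_cycle show ?thesis by blast
    qed
  qed
qed

section \<open>Matrix powers as sums over walks\<close>

definition hermitian_action :: "'v set \<Rightarrow> ('v \<Rightarrow> 'v \<Rightarrow> complex) \<Rightarrow> ('v \<Rightarrow> complex) \<Rightarrow> 'v \<Rightarrow> complex"
  where "hermitian_action V w f v = (\<Sum>u\<in>V. w v u * f u)"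

text \<open>Multiplying out the matrix product gives one term per walk of n steps; the fixed start
  \<open>v\<close> is not part of the summation list. A basis vector as \<open>f\<close> selects the
  end of the walk.\<close>

lemma funpow_hermitian_action:
  assumes "finite V"
  shows "(hermitian_action V w ^^ n) f v =
    (\<Sum>vs | set vs \<subseteq> V \<and> length vs = n. walk_weight w (v # vs) * f (last (v # vs)))"
proof (induction n arbitrary: v)
  case 0
  have "{vs. set vs \<subseteq> V \<and> length vs = 0} = {[]}" by auto
  then show ?case by simp
next
  case (Suc n)
  have eq: "{vs. set vs \<subseteq> V \<and> length vs = Suc n} =
      (\<lambda>(u, vs). u # vs) ` (V \<times> {vs. set vs \<subseteq> V \<and> length vs = n})"
    by (auto simp: length_Suc_conv image_iff)
  have inj: "inj_on (\<lambda>(u, vs). u # vs) (V \<times> {vs. set vs \<subseteq> V \<and> length vs = n})"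
    by (auto simp: inj_on_def)
  have "(hermitian_action V w ^^ Suc n) f v =
      (\<Sum>u\<in>V. w v u * (hermitian_action V w ^^ n) f u)"
    by (simp add: hermitian_action_def)
  also have "\<dots> = (\<Sum>u\<in>V. \<Sum>vs | set vs \<subseteq> V \<and> length vs = n.
      walk_weight w (v # u # vs) * f (last (v # u # vs)))"
    by (simp add: Suc sum_distrib_left mult.assoc)
  also have "\<dots> = (\<Sum>vs | set vs \<subseteq> V \<and> length vs = Suc n.
      walk_weight w (v # vs) * f (last (v # vs)))"
    unfolding eq sum.reindex[OF inj] by (simp add: sum.cartesian_product o_def case_prod_unfold)
  finally show ?case .
qed

subsection \<open>Finitely supported vectors\<close>

lemma summable_on_finite_support:
  fixes f :: "'a \<Rightarrow> 'b::{comm_monoid_add, t2_space}"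
  assumes "finite V" "\<And>i. i \<in> A - V \<Longrightarrow> f i = 0"
  shows "f summable_on A"
  using summable_on_cong_neutral[of "A \<inter> V" A f f] assms by auto

lemma infsum_finite_support:
  fixes f :: "'a \<Rightarrow> 'b::{comm_monoid_add, t2_space}"
  assumes "finite V" "\<And>i. i \<in> A - V \<Longrightarrow> f i = 0"
  shows "infsum f A = sum f (A \<inter> V)"
  using infsum_cong_neutral[of "A \<inter> V" A f f] assms by auto

text \<open>\<open>V\<close> may exceed \<open>A\<close>, so that inner products over
  \<open>C\<close> and over \<open>R\<close> become sums over the same \<open>V\<close>.\<close>

lemma infsum_finite_support':
  fixes f :: "'a \<Rightarrow> 'b::{comm_monoid_add, t2_space}"
  assumes "finite V" "\<And>i. i \<in> A - V \<Longrightarrow> f i = 0" "\<And>i. i \<in> V - A \<Longrightarrow> f i = 0"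
  shows "infsum f A = sum f V"
  using infsum_cong_neutral[of V A f f] assms by auto

lemma ell2_finite_support:
  assumes "finite V" "\<And>i. i \<notin> A \<Longrightarrow> f i = 0" "\<And>i. i \<notin> V \<Longrightarrow> f i = 0"
  shows "f \<in> ell2 A"
  using assms by (auto simp: ell2_def intro!: summable_on_finite_support[of V])

lemma basis_vec_in_ell2: "i \<in> A \<Longrightarrow> basis_vec i \<in> ell2 A"
  by (rule ell2_finite_support[of "{i}"]) (auto simp: basis_vec_def)

lemma ell2_inner_basis_vec_right: "i \<in> A \<Longrightarrow> ell2_inner A f (basis_vec i) = f i"
  unfolding ell2_inner_def
  by (subst infsum_finite_support[of "{i}"]) (auto simp: basis_vec_def)

lemma ell2_inner_basis_vec_left: "i \<in> A \<Longrightarrow> ell2_inner A (basis_vec i) f = cnj (f i)"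
  unfolding ell2_inner_def
  by (subst infsum_finite_support[of "{i}"]) (auto simp: basis_vec_def)

lemma ell2_norm_scaled_basis_vec:
  assumes "i \<in> A" shows "ell2_norm A (\<lambda>j. z * basis_vec i j) = cmod z"
  unfolding ell2_norm_def using assms
  by (subst infsum_finite_support[of "{i}"]) (auto simp: basis_vec_def)

lemma norm_le_ell2_norm:
  assumes "f \<in> ell2 A" "i \<in> A"
  shows "cmod (f i) \<le> ell2_norm A f"
proof -
  have "(\<Sum>j\<in>{i}. (cmod (f j))\<^sup>2) \<le> (\<Sum>\<^sub>\<infinity>j\<in>A. (cmod (f j))\<^sup>2)"
    using assms by (intro finite_sum_le_infsum) (auto simp: ell2_def)
  then show ?thesis by (simp add: ell2_norm_def real_le_rsqrt)
qed

text \<open>Uniqueness for the definite description: testing against basis vectors fixes the values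
  on \<open>A\<close>, and membership in \<open>ell2 A\<close> fixes them elsewhere.\<close>

lemma adjoint_op_eqI:
  assumes "h \<in> ell2 A" "\<And>f. f \<in> ell2 A \<Longrightarrow> ell2_inner B (x f) g = ell2_inner A f h"
  shows "adjoint_op A B x g = h"
  unfolding adjoint_op_def
proof (rule the_equality)
  fix h' assume h': "h' \<in> ell2 A \<and> (\<forall>f\<in>ell2 A. ell2_inner B (x f) g = ell2_inner A f h')"
  show "h' = h"
  proof
    fix i
    show "h' i = h i"
    proof (cases "i \<in> A")
      case True
      then have "ell2_inner A (basis_vec i) h' = ell2_inner A (basis_vec i) h"
        using h' assms basis_vec_in_ell2 by metis
      with True show ?thesis by (simp add: ell2_inner_basis_vec_left)
    qed (use h' assms in \<open>auto simp: ell2_def\<close>)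
  qed
qed (use assms in auto)

text \<open>The images are multiples of one basis vector, so it suffices that the bounded scalars
  \<open>F n c\<close> have a convergent subsequence.\<close>

lemma compact_elem_op:
  fixes A :: "'a set" and B :: "'b set"
  assumes "r \<in> B" "c \<in> A"
  shows "compact_operator A B (elem_op r c)"
  unfolding compact_operator_def
proof (intro conjI allI impI)
  have mem: "(\<lambda>j. z * basis_vec r j) \<in> ell2 B" for z
    using assms by (intro ell2_finite_support[of "{r}"]) (auto simp: basis_vec_def)
  then show "linear_operator A B (elem_op r c)"
    by (auto simp: linear_operator_def elem_op_def algebra_simps)
  fix F :: "nat \<Rightarrow> 'a \<Rightarrow> complex"
  assume F: "\<forall>n. F n \<in> ell2 A \<and> ell2_norm A (F n) \<le> 1"
  have "cmod (F n c) \<le> 1" for n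
    using F norm_le_ell2_norm[of "F n" A c] assms(2) by (meson order_trans)
  then have "\<forall>n. F n c \<in> cball 0 1" by simp
  then obtain l s where s: "strict_mono s" "((\<lambda>n. F n c) \<circ> s) \<longlonglongrightarrow> l"
    using compact_cball[of "0::complex" 1] unfolding compact_def by metis
  have "ell2_norm B (\<lambda>j. elem_op r c (F (s n)) j - l * basis_vec r j) = cmod (F (s n) c - l)" for n
    using ell2_norm_scaled_basis_vec[OF assms(1), of "F (s n) c - l"]
    by (simp add: elem_op_def left_diff_distrib)
  moreover have "(\<lambda>n. cmod (F (s n) c - l)) \<longlonglongrightarrow> 0"
    using s(2) by (simp add: o_def tendsto_norm_zero_iff LIM_zero_iff)
  ultimately show "\<exists>g\<in>ell2 B. \<exists>s. strict_mono s \<and>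
      (\<lambda>n. ell2_norm B (\<lambda>j. elem_op r c (F (s n)) j - g j)) \<longlonglongrightarrow> 0"
    using mem s(1) by (intro bexI[of _ "\<lambda>j. l * basis_vec r j"]) auto
qed

text \<open>Reversal exchanges the first and last vertices, which lie in different classes of a
  bipartite graph; this lets a cycle start in \<open>C\<close>.\<close>

lemma is_cycle_rev: "is_cycle V E (rev vs) \<longleftrightarrow> is_cycle V E vs"
  by (auto simp: is_cycle_def closed_walk_iff_successively hd_rev last_rev insert_commute)

subsection \<open>Traces as sums over closed walks\<close>

text \<open>For disjoint \<open>R\<close> and \<open>C\<close> this is the matrix of the
  self-adjoint block operator whose off-diagonal blocks are the combination with coefficients
  \<open>a\<close> and its adjoint. Its square acts on \<open>C\<close> as the Gram
  operator.\<close>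

definition herm_matrix :: "('v \<times> 'v) set \<Rightarrow> ('v \<times> 'v \<Rightarrow> complex) \<Rightarrow> 'v \<Rightarrow> 'v \<Rightarrow> complex" where
  "herm_matrix I a u v =
     (if (u, v) \<in> I then a (u, v) else if (v, u) \<in> I then cnj (a (v, u)) else 0)"

text \<open>Conjugation is multiplicative, so changing the signs multiplies each walk weight by the
  walk weight of the signs alone.\<close>

lemma herm_matrix_mult:
  "herm_matrix I (\<lambda>q. \<epsilon> q * a q) = (\<lambda>u v. herm_matrix I \<epsilon> u v * herm_matrix I a u v)"
  by (auto simp: herm_matrix_def fun_eq_iff)

lemma herm_matrix_nonzero_imp_edge: "herm_matrix I a u v \<noteq> 0 \<Longrightarrow> {u, v} \<in> bip_edges I"
  by (auto simp: herm_matrix_def bip_edges_def split: if_splits)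

locale bipartite_index =
  fixes R C :: "'v set" and I :: "('v \<times> 'v) set"
  assumes disjoint: "R \<inter> C = {}" and index_subset: "I \<subseteq> R \<times> C"
begin

lemma herm_matrix_swap: "herm_matrix I a v u = cnj (herm_matrix I a u v)"
  using disjoint index_subset by (auto simp: herm_matrix_def)

lemma edge_iff: "{u, v} \<in> bip_edges I \<longleftrightarrow> (u, v) \<in> I \<or> (v, u) \<in> I"
  by (auto simp: bip_edges_def doubleton_eq_iff insert_commute)

lemma edge_in_C_iff: "{u, v} \<in> bip_edges I \<Longrightarrow> u \<in> C \<longleftrightarrow> v \<notin> C"
  using disjoint index_subset by (auto simp: edge_iff)

lemma edge_vertex: "{u, v} \<in> bip_edges I \<Longrightarrow> u \<in> C \<union> R"
  using index_subset by (auto simp: edge_iff)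

text \<open>The two directions of an edge carry conjugate numbers of modulus 1.\<close>

lemma herm_matrix_unimodular:
  assumes "\<And>q. q \<in> I \<Longrightarrow> cmod (\<epsilon> q) = 1" "{u, v} \<in> bip_edges I"
  shows "herm_matrix I \<epsilon> u v * herm_matrix I \<epsilon> v u = 1"
proof -
  have "cmod (herm_matrix I \<epsilon> u v) = 1"
    using assms by (auto simp: herm_matrix_def edge_iff)
  then show ?thesis by (simp add: herm_matrix_swap[of _ v u] complex_norm_square [symmetric])
qed

section \<open>The operator, its adjoint and its Gram powers as one finite Hermitian matrix\<close>

context
  fixes a :: "'v \<times> 'v \<Rightarrow> complex" and V :: "'v set"
  assumes finite_V: "finite V"
    and support: "\<And>r c. (r, c) \<in> I \<Longrightarrow> a (r, c) \<noteq> 0 \<Longrightarrow> r \<in> V \<and> c \<in> V"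
begin

abbreviation (input) "W \<equiv> herm_matrix I a"
abbreviation (input) "T \<equiv> hermitian_action V W"
abbreviation (input) "x \<equiv> lin_comb I a (\<lambda>(r, c). elem_op r c)"

lemma hermitian_action_outside: "v \<notin> V \<Longrightarrow> T f v = 0"
  unfolding hermitian_action_def using support
  by (intro sum.neutral) (auto simp: herm_matrix_def)

text \<open>No entry joins two vertices of the same class, so \<open>T\<close> exchanges vectors
  supported in \<open>C\<close> and vectors supported in \<open>R\<close>.\<close>

lemma hermitian_action_C_to_R: "(\<And>i. i \<notin> C \<Longrightarrow> f i = 0) \<Longrightarrow> v \<notin> R \<Longrightarrow> T f v = 0"
  unfolding hermitian_action_def using disjoint index_subset
  by (intro sum.neutral) (auto simp: herm_matrix_def)

lemma hermitian_action_R_to_C: "(\<And>i. i \<notin> R \<Longrightarrow> f i = 0) \<Longrightarrow> v \<notin> C \<Longrightarrow> T f v = 0"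
  unfolding hermitian_action_def using disjoint index_subset
  by (intro sum.neutral) (auto simp: herm_matrix_def)

lemma lin_comb_eq_hermitian_action:
  assumes "\<And>i. i \<notin> C \<Longrightarrow> f i = 0"
  shows "x f = T f"
proof
  fix r
  define F where "F = {q \<in> I. a q \<noteq> 0}"
  have "F \<subseteq> V \<times> V" using support by (auto simp: F_def)
  then have fin: "finite F" using finite_V finite_subset by blast
  have "x f r = (\<Sum>q\<in>F. if fst q = r then a q * f (snd q) else 0)"
    unfolding lin_comb_def F_def
    by (intro sum.cong) (auto simp: elem_op_def basis_vec_def)
  also have "\<dots> = (\<Sum>q\<in>{q \<in> F. fst q = r}. a q * f (snd q))"
    using fin by (simp add: sum.inter_filter)
  also have "\<dots> = (\<Sum>u\<in>{u \<in> V. (r, u) \<in> F}. a (r, u) * f u)"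
    by (rule sum.reindex_bij_witness[of _ "Pair r" snd]) (use support in \<open>auto simp: F_def\<close>)
  also have "\<dots> = (\<Sum>u\<in>V. if (r, u) \<in> F then a (r, u) * f u else 0)"
    using finite_V by (simp add: sum.inter_filter)
  also have "\<dots> = T f r"
    unfolding hermitian_action_def
  proof (intro sum.cong refl)
    fix u
    \<comment> \<open>The conjugated entries of the matrix meet only coordinates in
      \<open>R\<close>, where \<open>f\<close> vanishes.\<close>
    have "(u, r) \<in> I \<Longrightarrow> f u = 0" using assms disjoint index_subset by blast
    then show "(if (r, u) \<in> F then a (r, u) * f u else 0) = W r u * f u"
      by (auto simp: herm_matrix_def F_def)
  qed
  finally show "x f r = T f r" .
qed

text \<open>The matrix is Hermitian, so interchanging two finite sums moves \<open>T\<close> to the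
  other side of the inner product.\<close>

lemma adjoint_lin_comb:
  assumes g: "\<And>i. i \<notin> R \<Longrightarrow> g i = 0"
  shows "adjoint_op C R x g = T g"
proof (rule adjoint_op_eqI)
  show "T g \<in> ell2 C"
    using finite_V
    by (rule ell2_finite_support) (auto simp: hermitian_action_R_to_C g hermitian_action_outside)
next
  fix f assume "f \<in> ell2 C"
  then have f: "\<And>i. i \<notin> C \<Longrightarrow> f i = 0" by (simp add: ell2_def)
  have "x f = T f" using f by (rule lin_comb_eq_hermitian_action)
  then have "ell2_inner R (x f) g = (\<Sum>v\<in>V. T f v * cnj (g v))"
    unfolding ell2_inner_def
    using finite_V g hermitian_action_outside by (auto intro!: infsum_finite_support')
  also have "\<dots> = (\<Sum>v\<in>V. \<Sum>u\<in>V. f u * (W v u * cnj (g v)))"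
    by (simp add: hermitian_action_def sum_distrib_right sum_distrib_left mult_ac)
  also have "\<dots> = (\<Sum>u\<in>V. \<Sum>v\<in>V. f u * (W v u * cnj (g v)))"
    by (rule sum.swap)
  also have "\<dots> = (\<Sum>u\<in>V. f u * cnj (T g u))"
    by (intro sum.cong refl)
      (simp add: hermitian_action_def sum_distrib_left herm_matrix_swap[of a, symmetric])
  also have "\<dots> = ell2_inner C f (T g)"
    unfolding ell2_inner_def
    using finite_V f hermitian_action_outside by (auto intro!: infsum_finite_support'[symmetric])
  finally show "ell2_inner R (x f) g = ell2_inner C f (T g)" .
qed

text \<open>Each Gram factor is two applications of \<open>T\<close>. The support claim is carried
  along because \<open>x\<close> agrees with \<open>T\<close> only on vectors supported in
  \<open>C\<close>.\<close>

lemma gram_iterate: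
  assumes f: "\<And>i. i \<notin> C \<Longrightarrow> f i = 0"
  shows "((\<lambda>f. adjoint_op C R x (x f)) ^^ k) f = (T ^^ (2 * k)) f \<and>
    (\<forall>i. i \<notin> C \<longrightarrow> (T ^^ (2 * k)) f i = 0)"
proof (induction k)
  case (Suc k)
  then have *: "x ((T ^^ (2 * k)) f) = T ((T ^^ (2 * k)) f)"
    by (intro lin_comb_eq_hermitian_action) auto
  have z: "T ((T ^^ (2 * k)) f) i = 0" if "i \<notin> R" for i
    using that Suc by (intro hermitian_action_C_to_R) auto
  then have "adjoint_op C R x (T ((T ^^ (2 * k)) f)) = T (T ((T ^^ (2 * k)) f))"
    by (rule adjoint_lin_comb)
  moreover have "T (T ((T ^^ (2 * k)) f)) i = 0" if "i \<notin> C" for i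
    using z that by (rule hermitian_action_R_to_C)
  ultimately show ?case using Suc * by simp
qed (use f in auto)

lemma gram_power_diagonal:
  assumes "even p" "c \<in> C"
  shows "ell2_inner C (gram_power C R p x (basis_vec c)) (basis_vec c) =
    (T ^^ p) (basis_vec c) c"
proof -
  have "\<And>i. i \<notin> C \<Longrightarrow> basis_vec c i = 0" using assms(2) by (auto simp: basis_vec_def)
  from gram_iterate[of "basis_vec c" "p div 2", OF this] assms show ?thesis
    by (simp add: ell2_inner_basis_vec_right gram_power_def)
qed

text \<open>A positive power ends with an application of \<open>T\<close>, whose values vanish off
  \<open>V\<close>; for \<open>p = 0\<close> the entry would be 1.\<close>

lemma gram_power_diagonal_outside:
  assumes "even p" "0 < p" "c \<in> C" "c \<notin> V"
  shows "ell2_inner C (gram_power C R p x (basis_vec c)) (basis_vec c) = 0"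
  using assms hermitian_action_outside
  by (cases p) (auto simp: gram_power_diagonal)

text \<open>The diagonal entry at \<open>c\<close> collects the walks of \<open>p\<close> steps that
  return to \<open>c\<close>, and it vanishes for \<open>c\<close> outside \<open>V\<close>.\<close>

lemma trace_gram_power:
  assumes "even p" "0 < p"
  shows "op_trace C (gram_power C R p x) =
    (\<Sum>(c, vs) \<in> (C \<inter> V) \<times> {vs. set vs \<subseteq> V \<and> length vs = p}.
      if last (c # vs) = c then walk_weight W (c # vs) else 0)"
proof -
  have "op_trace C (gram_power C R p x) = (\<Sum>c\<in>C \<inter> V. (T ^^ p) (basis_vec c) c)"
    unfolding op_trace_def using assms finite_V
    by (subst infsum_finite_support[of V])
      (auto simp: gram_power_diagonal_outside gram_power_diagonal)
  also have "\<dots> = (\<Sum>c\<in>C \<inter> V. \<Sum>vs | set vs \<subseteq> V \<and> length vs = p.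
      if last (c # vs) = c then walk_weight W (c # vs) else 0)"
    by (intro sum.cong refl)
      (auto simp: funpow_hermitian_action[OF finite_V] basis_vec_def intro!: sum.cong)
  finally show ?thesis by (simp add: sum.cartesian_product)
qed

lemma summable_gram_power_diagonal:
  assumes "even p" "0 < p"
  shows "(\<lambda>c. ell2_inner C (gram_power C R p x (basis_vec c)) (basis_vec c)) summable_on C"
  by (rule summable_on_finite_support[OF finite_V]) (auto simp: gram_power_diagonal_outside assms)

end

lemma elem_op_in_schatten_class:
  assumes "(r, c) \<in> I" "even p" "0 < p"
  shows "elem_op r c \<in> schatten_class C R p"
proof -
  \<comment> \<open>A single coefficient 1 makes the elementary operator a combination, so the
    summability of combinations applies.\<close>
  let ?a = "\<lambda>q. if q = (r, c) then 1 else 0 :: complex"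
  have supp: "{q \<in> I. ?a q \<noteq> 0} = {(r, c)}" using assms(1) by auto
  have "lin_comb I ?a (\<lambda>(r, c). elem_op r c) = elem_op r c"
    unfolding lin_comb_def supp by (simp add: fun_eq_iff)
  moreover have "compact_operator C R (elem_op r c)"
    using assms(1) index_subset by (intro compact_elem_op) auto
  ultimately show ?thesis
    using summable_gram_power_diagonal[of "{r, c}" ?a p] assms(2,3)
    by (auto simp: schatten_class_def split: if_splits)
qed

subsection \<open>Unconditionality and cycles\<close>

text \<open>The signs multiply the weight of each closed walk by a factor that is 1 in the absence
  of short cycles, so the two traces agree term by term.\<close>

lemma unconditional_if_no_cycle:
  assumes p: "even p" "0 < p"
    and no_cycle: "\<And>vs. is_cycle (C \<union> R) (bip_edges I) vs \<Longrightarrow> even (length vs) \<Longrightarrow>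
      length vs \<le> p \<Longrightarrow> False"
    and S: "S \<subseteq> {z. cmod z = 1}"
  shows "one_unconditional_wrt S C R p I (\<lambda>(r, c). elem_op r c)"
  unfolding one_unconditional_wrt_def
proof (intro conjI allI impI ballI)
  fix q assume "q \<in> I"
  with p show "(case q of (r, c) \<Rightarrow> elem_op r c) \<in> schatten_class C R p"
    by (cases q) (auto intro: elem_op_in_schatten_class)
next
  fix \<epsilon> a
  assume \<epsilon>: "\<forall>q\<in>I. \<epsilon> q \<in> S" and fin: "finite {q \<in> I. a q \<noteq> (0::complex)}"
  define V where "V = fst ` {q \<in> I. a q \<noteq> 0} \<union> snd ` {q \<in> I. a q \<noteq> 0}"
  have V: "finite V" using fin by (simp add: V_def)
  have supp: "r \<in> V \<and> c \<in> V" if "(r, c) \<in> I" "a (r, c) \<noteq> 0" for r c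
    using that by (force simp: V_def)
  have "(if last (c # vs) = c then walk_weight (herm_matrix I (\<lambda>q. \<epsilon> q * a q)) (c # vs) else 0) =
      (if last (c # vs) = c then walk_weight (herm_matrix I a) (c # vs) else 0)"
    if "length vs = p" for c vs
  proof (cases "last (c # vs) = c \<and> walk_weight (herm_matrix I a) (c # vs) \<noteq> 0")
    case True
    then have "successively (\<lambda>u v. herm_matrix I a u v \<noteq> 0) (c # vs)"
      by (simp add: walk_weight_nonzero)
    then have "successively (\<lambda>u v. {u, v} \<in> bip_edges I) (c # vs)"
      by (rule successively_mono) (rule herm_matrix_nonzero_imp_edge)
    then have "walk_weight (herm_matrix I \<epsilon>) (c # vs) = 1"
      using True that no_cycle \<epsilon> S
      by (intro walk_weight_closed_eq_1[where n = p and E = "bip_edges I" and V = "C \<union> R" and C = C])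
        (auto intro!: herm_matrix_unimodular dest: edge_in_C_iff edge_vertex)
    then show ?thesis by (simp add: herm_matrix_mult walk_weight_mult)
  qed (auto simp: herm_matrix_mult walk_weight_mult)
  then have "op_trace C (gram_power C R p (lin_comb I (\<lambda>q. \<epsilon> q * a q) (\<lambda>(r, c). elem_op r c))) =
      op_trace C (gram_power C R p (lin_comb I a (\<lambda>(r, c). elem_op r c)))"
    using p V supp by (subst (1 2) trace_gram_power[of V]) (auto intro!: sum.cong)
  then show "schatten_norm C R p (lin_comb I (\<lambda>q. \<epsilon> q * a q) (\<lambda>(r, c). elem_op r c)) =
      schatten_norm C R p (lin_comb I a (\<lambda>(r, c). elem_op r c))"
    by (simp add: schatten_norm_def)
qed

text \<open>The coefficients are the indicator of the edges inside the cycle, and the sign is changed on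
  one edge of the cycle only. No closed walk gains real part under this change, and the walk
  that runs around the cycle once and then back and forth on the distinguished edge goes
  from 1 to -1.\<close>

lemma not_unconditional_if_cycle:
  assumes p: "even p"
    and cycle: "is_cycle (C \<union> R) (bip_edges I) vs" "even (length vs)" "length vs \<le> p"
    and S: "{-1, 1} \<subseteq> S"
  shows "\<not> one_unconditional_wrt S C R p I (\<lambda>(r, c). elem_op r c)"
proof -
  \<comment> \<open>The trace counts only walks that start in \<open>C\<close>.\<close>
  have wlog: "\<exists>vs. is_cycle (C \<union> R) (bip_edges I) vs \<and> even (length vs) \<and> length vs \<le> p \<and> hd vs \<in> C"
  proof (cases "hd vs \<in> C")
    case False
    have "{last vs, hd vs} \<in> bip_edges I" and "vs \<noteq> []"
      using cycle by (auto simp: is_cycle_def closed_walk_def)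
    then have "hd (rev vs) \<in> C" using False edge_in_C_iff by (metis hd_rev)
    with cycle show ?thesis by (intro exI[of _ "rev vs"]) (simp add: is_cycle_rev)
  qed (use cycle in blast)
  then obtain vs where cyc: "is_cycle (C \<union> R) (bip_edges I) vs" and ev: "even (length vs)"
    and len: "length vs \<le> p" and hdC: "hd vs \<in> C" by blast
  from cyc have dist: "distinct vs" and len4: "4 \<le> length vs" and ne: "vs \<noteq> []"
    and succ: "successively (\<lambda>x y. {x, y} \<in> bip_edges I) vs"
    and closing: "{last vs, hd vs} \<in> bip_edges I"
    by (auto simp: is_cycle_def closed_walk_iff_successively)
  define V where "V = set vs"
  define u where "u = hd vs"
  define w where "w = last vs"
  have uV: "u \<in> V" and wV: "w \<in> V" using ne by (auto simp: u_def w_def V_def)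
  define a :: "'v \<times> 'v \<Rightarrow> complex" where "a = (\<lambda>(r, c). if r \<in> V \<and> c \<in> V then 1 else 0)"
  \<comment> \<open>The sign is changed on the closing edge, which the list \<open>vs\<close> itself
    does not traverse.\<close>
  define \<epsilon> :: "'v \<times> 'v \<Rightarrow> complex" where "\<epsilon> = (\<lambda>(r, c). if {r, c} = {w, u} then -1 else 1)"
  define adj :: "'v \<Rightarrow> 'v \<Rightarrow> real"
    where "adj = (\<lambda>x y. if {x, y} \<in> bip_edges I \<and> x \<in> V \<and> y \<in> V then 1 else 0)"
  have Wa: "herm_matrix I a = (\<lambda>x y. of_real (adj x y))"
    by (auto simp: fun_eq_iff herm_matrix_def a_def adj_def edge_iff)
  have weps: "herm_matrix I \<epsilon> x y = (if {x, y} = {w, u} then -1 else 1)"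
    if "{x, y} \<in> bip_edges I" for x y
    using that by (auto simp: herm_matrix_def \<epsilon>_def edge_iff insert_commute)
  have norm_W: "cmod (herm_matrix I (\<lambda>q. \<epsilon> q * a q) x y) = adj x y" for x y
    by (auto simp: herm_matrix_def a_def \<epsilon>_def adj_def edge_iff)
  have finV: "finite V" by (simp add: V_def)
  have supp: "r \<in> V \<and> c \<in> V" if "(r, c) \<in> I" "a (r, c) \<noteq> 0" for r c
    using that by (auto simp: a_def split: if_splits)
  have supp': "r \<in> V \<and> c \<in> V" if "(r, c) \<in> I" "\<epsilon> (r, c) * a (r, c) \<noteq> 0" for r c
    using that supp by auto
  \<comment> \<open>Signs preserve absolute values and the entries for \<open>a\<close> are 0 or 1,
    so the weight for \<open>a\<close> is the modulus of the changed weight.\<close>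
  have le: "Re (walk_weight (herm_matrix I (\<lambda>q. \<epsilon> q * a q)) ws) \<le> Re (walk_weight (herm_matrix I a) ws)"
    for ws
  proof -
    have "Re (walk_weight (herm_matrix I (\<lambda>q. \<epsilon> q * a q)) ws) \<le>
        cmod (walk_weight (herm_matrix I (\<lambda>q. \<epsilon> q * a q)) ws)"
      by (rule complex_Re_le_cmod)
    also have "\<dots> = Re (walk_weight (herm_matrix I a) ws)"
      by (simp add: walk_weight_norm norm_W Wa walk_weight_of_real)
    finally show ?thesis .
  qed
  have nth_edge: "{vs ! i, vs ! Suc i} \<noteq> {w, u}" if "Suc i < length vs" for i
  proof
    assume "{vs ! i, vs ! Suc i} = {w, u}"
    then have "vs ! i = vs ! (length vs - 1) \<or> vs ! i = vs ! 0 \<and> vs ! Suc i = vs ! (length vs - 1)"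
      using ne by (auto simp: w_def u_def last_conv_nth hd_conv_nth doubleton_eq_iff)
    \<comment> \<open>The first case contradicts the range of \<open>i\<close>; the second would
      make the cycle have length 2.\<close>
    then have "i = length vs - 1 \<or> i = 0 \<and> Suc i = length vs - 1"
      using that ne dist by (subst (asm) (1 2 3) nth_eq_iff_index_eq) auto
    with that len4 show False by auto
  qed
  have "walk_weight (herm_matrix I \<epsilon>) vs = walk_weight (\<lambda>x y. 1) vs"
    using nth_edge succ by (intro walk_weight_cong) (auto simp: successively_conv_nth weps)
  then have eps_vs: "walk_weight (herm_matrix I \<epsilon>) vs = 1" by (simp add: walk_weight_1)
  have "walk_weight (herm_matrix I a) vs = walk_weight (\<lambda>x y. 1) vs"
    using succ by (intro walk_weight_cong) (auto simp: successively_conv_nth Wa adj_def V_def)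
  then have a_vs: "walk_weight (herm_matrix I a) vs = 1" by (simp add: walk_weight_1)
  \<comment> \<open>From \<open>u\<close>, go to \<open>w\<close> and back \<open>m\<close> times,
    which takes \<open>2 * m\<close> steps.\<close>
  define bounce where "bounce = (\<lambda>m. u # concat (replicate m [w, u]))"
  have bounce: "walk_weight f (bounce m) = (f u w * f w u) ^ m" for f :: "'v \<Rightarrow> 'v \<Rightarrow> complex" and m
    by (induction m) (auto simp: bounce_def mult_ac)
  have bounce_last: "last (bounce m) = u" and bounce_length: "length (bounce m) = Suc (2 * m)"
    and bounce_set: "set (bounce m) \<subseteq> V" for m
    using uV wV by (induction m) (auto simp: bounce_def)
  \<comment> \<open>Going round the cycle takes \<open>length vs\<close> steps. Since
    \<open>p\<close> and \<open>length vs\<close> are even, \<open>2 * m\<close> steps remain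
    exactly.\<close>
  define m where "m = (p - length vs) div 2"
  define ws where "ws = tl vs @ bounce m"
  have uws: "u # ws = vs @ bounce m" using ne by (simp add: u_def ws_def)
  have weight_ws: "walk_weight f (u # ws) = walk_weight f vs * f w u * (f u w * f w u) ^ m"
    for f :: "'v \<Rightarrow> 'v \<Rightarrow> complex"
  proof -
    have vs: "vs = butlast vs @ [w]" using ne by (simp add: w_def)
    have "walk_weight f (u # ws) = walk_weight f (butlast vs @ w # bounce m)"
      unfolding uws by (subst vs) simp
    also have "\<dots> = walk_weight f vs * walk_weight f (w # bounce m)"
      using walk_weight_append[of f "butlast vs" w "bounce m"] vs by simp
    also have "walk_weight f (w # bounce m) = f w u * walk_weight f (bounce m)"
      by (simp add: bounce_def)
    finally show ?thesis by (simp add: bounce mult_ac)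
  qed
  have "{w, u} \<in> bip_edges I" using closing by (simp add: w_def u_def)
  \<comment> \<open>The closing edge is traversed \<open>2 * m + 1\<close> times: once to close the
    cycle and an even number of times in \<open>bounce m\<close>. Hence the sign -1.\<close>
  then have a_ws: "walk_weight (herm_matrix I a) (u # ws) = 1"
    and eps_ws: "walk_weight (herm_matrix I \<epsilon>) (u # ws) = -1"
    using uV wV unfolding weight_ws a_vs eps_vs by (simp_all add: weps Wa adj_def insert_commute)
  have "bounce m \<noteq> []" by (simp add: bounce_def)
  then have last_ws: "last (u # ws) = u" unfolding uws by (simp add: bounce_last)
  have length_ws: "length ws = p"
    using ev len len4 p by (simp add: ws_def bounce_length m_def)
  have "set (u # ws) \<subseteq> V" unfolding uws using bounce_set[of m] by (simp add: V_def)
  then have ws: "set ws \<subseteq> V" "length ws = p" "last (u # ws) = u"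
    using last_ws length_ws by auto
  let ?e = "\<lambda>(r, c). elem_op r c"
  have p0: "0 < p" using len len4 by simp
  define L where "L = (C \<inter> V) \<times> {vs. set vs \<subseteq> V \<and> length vs = p}"
  define t where "t = (\<lambda>b (c, vs). if last (c # vs) = c then walk_weight (herm_matrix I b) (c # vs) else 0)"
  have trace: "op_trace C (gram_power C R p (lin_comb I b ?e)) = (\<Sum>y\<in>L. t b y)"
    if "\<And>r c. (r, c) \<in> I \<Longrightarrow> b (r, c) \<noteq> 0 \<Longrightarrow> r \<in> V \<and> c \<in> V" for b
    unfolding L_def t_def using finV that p p0 by (rule trace_gram_power)
  have "(\<Sum>y\<in>L. Re (t (\<lambda>q. \<epsilon> q * a q) y)) < (\<Sum>y\<in>L. Re (t a y))"
  proof (rule sum_strict_mono_ex1)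
    show "finite L" using finV by (simp add: L_def finite_lists_length_eq)
    show "\<forall>y\<in>L. Re (t (\<lambda>q. \<epsilon> q * a q) y) \<le> Re (t a y)"
      using le by (auto simp: t_def)
    have "(u, ws) \<in> L" using ws uV hdC by (simp add: L_def u_def)
    moreover have "t (\<lambda>q. \<epsilon> q * a q) (u, ws) = -1" "t a (u, ws) = 1"
      unfolding t_def prod.case ws(3) by (simp_all add: herm_matrix_mult walk_weight_mult a_ws eps_ws)
    ultimately show "\<exists>y\<in>L. Re (t (\<lambda>q. \<epsilon> q * a q) y) < Re (t a y)"
      by (intro bexI[of _ "(u, ws)"]) auto
  qed
  then have "Re (op_trace C (gram_power C R p (lin_comb I (\<lambda>q. \<epsilon> q * a q) ?e))) <
      Re (op_trace C (gram_power C R p (lin_comb I a ?e)))"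
    using trace[of "\<lambda>q. \<epsilon> q * a q"] trace[of a] supp supp' by (simp add: Re_sum)
  moreover have "\<forall>q\<in>I. \<epsilon> q \<in> S" using S by (auto simp: \<epsilon>_def)
  moreover have "finite {q \<in> I. a q \<noteq> 0}"
    by (rule finite_subset[of _ "V \<times> V"]) (use supp finV in auto)
  \<comment> \<open>\<open>root p\<close> is strictly increasing for positive \<open>p\<close>, so
    different real parts of the traces give different norms.\<close>
  ultimately show ?thesis
    using p0 by (force simp: one_unconditional_wrt_def schatten_norm_def)
qed

end

theorem theorem1p5:
  fixes R C :: "'v set" and I :: "('v \<times> 'v) set" and p :: nat
  assumes "countable R" and "countable C" and "R \<inter> C = {}"
    and "I \<subseteq> R \<times> C"
    and "even p" and "2 \<le> p"
  shows "(complex_one_unconditional C R p I (\<lambda>(r, c). elem_op r c) \<longleftrightarrow>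
            \<not> (\<exists>vs. is_cycle (C \<union> R) (bip_edges I) vs \<and>
                  length vs \<in> {l. even l \<and> 4 \<le> l \<and> l \<le> p})) \<and>
         (real_one_unconditional C R p I (\<lambda>(r, c). elem_op r c) \<longleftrightarrow>
            \<not> (\<exists>vs. is_cycle (C \<union> R) (bip_edges I) vs \<and>
                  length vs \<in> {l. even l \<and> 4 \<le> l \<and> l \<le> p}))"
proof -
  interpret bipartite_index R C I by unfold_locales (fact assms)+
  \<comment> \<open>The obstruction uses only the signs -1 and 1, and the converse only modulus 1,
    so every \<open>S\<close> between these two sets has the same criterion.\<close>
  have "one_unconditional_wrt S C R p I (\<lambda>(r, c). elem_op r c) \<longleftrightarrow>
      \<not> (\<exists>vs. is_cycle (C \<union> R) (bip_edges I) vs \<and> length vs \<in> {l. even l \<and> 4 \<le> l \<and> l \<le> p})"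
    if S: "{-1, 1} \<subseteq> S" "S \<subseteq> {z. cmod z = 1}" for S
  proof
    assume "one_unconditional_wrt S C R p I (\<lambda>(r, c). elem_op r c)"
    with not_unconditional_if_cycle[OF \<open>even p\<close> _ _ _ S(1)]
    show "\<not> (\<exists>vs. is_cycle (C \<union> R) (bip_edges I) vs \<and> length vs \<in> {l. even l \<and> 4 \<le> l \<and> l \<le> p})"
      by blast
  next
    assume no_cycle: "\<not> (\<exists>vs. is_cycle (C \<union> R) (bip_edges I) vs \<and> length vs \<in> {l. even l \<and> 4 \<le> l \<and> l \<le> p})"
    show "one_unconditional_wrt S C R p I (\<lambda>(r, c). elem_op r c)"
      by (rule unconditional_if_no_cycle[OF \<open>even p\<close> _ _ S(2)])
        (use no_cycle \<open>2 \<le> p\<close> in \<open>auto simp: is_cycle_def\<close>)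
  qed
  then show ?thesis
    by (simp add: complex_one_unconditional_def real_one_unconditional_def)
qed

end
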